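(* Let $d\ge2$, let $r\in\,]0,1[$, and consider a system of three inelastic particles $0,1,2$ in $\mathbb{R}^d$ evolving according to the $r$-inelastic hard sphere flow on a time interval $[0,\tau^*[$ and undergoing an inelastic collapse at time $\tau^*>0$, with collision times $(t_n)_n$, such that particle $0$ is involved in infinitely many collisions with each of the two particles $1$ and $2$. Then the sequences of angular parameters $(\omega_{1,n})_{n\in\mathbb{N}}$ and $(\omega_{2,n})_{n\in\mathbb{N}}$, defined by $\omega_{i,n}=x_i(t_n)-x_0(t_n)$ for $i\in\{1,2\}$, and the sequence $(d_n)_n$ of distances between the central particle $0$ and the spectator particle, are converging, and $$d_n\xrightarrow[n\to+\infty]{}0.$$
   Context: Model. Three identical spherical particles $0,1,2$ of diameter $1$ in $\mathbb{R}^d$ ($d\ge2$), with positions $x_i$ and velocities $v_i$, and $|x_i-x_j|\ge1$ for $i\ne j$. The $r$-inelastic hard sphere flow, $r\in\,]0,1[$: between collisions each particle moves in a straight line with constant velocity; when $|x_i-x_j|=1$ for a pair $i\neq j$ (a collision of type $i$-$j$), the velocities of these two particles are immediately changed into $v_i'=v_i-\frac{1+r}{2}\big((v_i-v_j)\cdot\omega\big)\omega$ and $v_j'=v_j+\frac{1+r}{2}\big((v_i-v_j)\cdot\omega\big)\omega$, with $\omega=(x_i-x_j)/|x_i-x_j|$, the velocity of the third particle being unchanged. Inelastic collapse at time $\tau^*>0$: the system evolves according to this flow on $[0,\tau^*[$ and there is an increasing sequence $(t_n)_{n\in\mathbb{N}}$ with $t_0=0$, $t_n\to\tau^*$, such that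 the $t_n$ are exactly the times of collisions (no accumulation point other than $\tau^*$, free motion on each $]t_n,t_{n+1}[$). Only well-defined trajectories are considered: no triple collision and no grazing collision takes place on $[0,\tau^*[$. Distance $d_n$: when the collision at time $t_n$ is of type $0$-$i$ with $i\in\{1,2\}$, the spectator is the remaining particle $j\in\{1,2\}\setminus\{i\}$, and $d_n=|x_j(t_n)-x_0(t_n)|-1$ (distance between the surfaces); the sequence $(d_n)$ is indexed by those collisions. *)

theory Defs
  imports "HOL-Analysis.Analysis"
begin

text \<open>Particles are the indices \<open>0, 1, 2\<close>; \<open>x i s\<close> is the position of particle \<open>i\<close> at
  time \<open>s\<close>. All particles have diameter \<open>1\<close>.\<close>

definition collides :: "(nat \<Rightarrow> real \<Rightarrow> 'a::real_normed_vector) \<Rightarrow> nat \<Rightarrow> nat \<Rightarrow> real \<Rightarrow> bool" where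
  "collides x i j s \<longleftrightarrow> i < 3 \<and> j < 3 \<and> i \<noteq> j \<and> norm (x i s - x j s) = 1"

definition impact_dir :: "(nat \<Rightarrow> real \<Rightarrow> 'a::real_normed_vector) \<Rightarrow> nat \<Rightarrow> nat \<Rightarrow> real \<Rightarrow> 'a" where
  "impact_dir x i j s = (x i s - x j s) /\<^sub>R norm (x i s - x j s)"

text \<open>The velocity jumps at a collision, so it is given by two functions: \<open>v i s\<close> is the velocity
  just before time \<open>s\<close> (at \<open>s = 0\<close>: the initial velocity) and \<open>v' i s\<close> the one just after it.
  They agree for a particle that is not colliding at time \<open>s\<close>.\<close>

definition inelastic_flow ::
  "real \<Rightarrow> real \<Rightarrow> (nat \<Rightarrow> real \<Rightarrow> 'a::real_inner) \<Rightarrow> (nat \<Rightarrow> real \<Rightarrow> 'a) \<Rightarrow> (nat \<Rightarrow> real \<Rightarrow> 'a) \<Rightarrow> bool"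
where
  "inelastic_flow r \<tau> x v v' \<longleftrightarrow>
     (\<forall>s\<in>{0..<\<tau>}. \<forall>i<3. \<forall>j<3. i \<noteq> j \<longrightarrow> norm (x i s - x j s) \<ge> 1) \<and>
     (\<forall>s\<in>{0..<\<tau>}. \<forall>i j. collides x i j s \<longrightarrow>
        (let \<omega> = impact_dir x i j s in
          v' i s = v i s - (((1 + r) / 2) * ((v i s - v j s) \<bullet> \<omega>)) *\<^sub>R \<omega> \<and>
          v' j s = v j s + (((1 + r) / 2) * ((v i s - v j s) \<bullet> \<omega>)) *\<^sub>R \<omega>)) \<and>
     (\<forall>s\<in>{0..<\<tau>}. \<forall>i<3. (\<nexists>j. collides x i j s) \<longrightarrow> v' i s = v i s) \<and>
     (\<forall>a b. 0 \<le> a \<and> a < b \<and> b < \<tau> \<and> (\<forall>s\<in>{a<..<b}. \<nexists>i j. collides x i j s) \<longrightarrow>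
        (\<forall>i<3. \<forall>s\<in>{a<..b}. x i s = x i a + (s - a) *\<^sub>R v' i a \<and> v i s = v' i a))"

definition no_triple_collision :: "real \<Rightarrow> (nat \<Rightarrow> real \<Rightarrow> 'a::real_normed_vector) \<Rightarrow> bool" where
  "no_triple_collision \<tau> x \<longleftrightarrow>
     (\<forall>s\<in>{0..<\<tau>}. \<forall>i j k l. collides x i j s \<and> collides x k l s \<longrightarrow> {i, j} = {k, l})"

definition no_grazing_collision ::
  "real \<Rightarrow> (nat \<Rightarrow> real \<Rightarrow> 'a::real_inner) \<Rightarrow> (nat \<Rightarrow> real \<Rightarrow> 'a) \<Rightarrow> bool" where
  "no_grazing_collision \<tau> x v \<longleftrightarrow>
     (\<forall>s\<in>{0..<\<tau>}. \<forall>i j. collides x i j s \<longrightarrow> (v i s - v j s) \<bullet> impact_dir x i j s \<noteq> 0)"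

definition inelastic_collapse ::
  "real \<Rightarrow> real \<Rightarrow> (nat \<Rightarrow> real \<Rightarrow> 'a::real_inner) \<Rightarrow> (nat \<Rightarrow> real \<Rightarrow> 'a) \<Rightarrow> (nat \<Rightarrow> real \<Rightarrow> 'a)
    \<Rightarrow> (nat \<Rightarrow> real) \<Rightarrow> bool" where
  "inelastic_collapse r \<tau> x v v' t \<longleftrightarrow>
     inelastic_flow r \<tau> x v v' \<and> no_triple_collision \<tau> x \<and> no_grazing_collision \<tau> x v \<and>
     strict_mono t \<and> t 0 = 0 \<and> t \<longlonglongrightarrow> \<tau> \<and>
     range t = {s \<in> {0..<\<tau>}. \<exists>i j. collides x i j s}"

text \<open>The central particle is \<open>0\<close>. The spectator is meaningful only at a collision of type
  \<open>0\<close>-\<open>1\<close> or \<open>0\<close>-\<open>2\<close>; the sequence of distances runs over exactly these collisions, so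
  it is reindexed by the increasing enumeration of the corresponding set of \<open>n\<close>.\<close>

definition central_collisions ::
  "(nat \<Rightarrow> real \<Rightarrow> 'a::real_normed_vector) \<Rightarrow> (nat \<Rightarrow> real) \<Rightarrow> nat set" where
  "central_collisions x t = {n. collides x 0 1 (t n) \<or> collides x 0 2 (t n)}"

definition spectator :: "(nat \<Rightarrow> real \<Rightarrow> 'a::real_normed_vector) \<Rightarrow> real \<Rightarrow> nat" where
  "spectator x s = (if collides x 0 1 s then 2 else 1)"

definition spectator_dist ::
  "(nat \<Rightarrow> real \<Rightarrow> 'a::real_normed_vector) \<Rightarrow> (nat \<Rightarrow> real) \<Rightarrow> nat \<Rightarrow> real" where
  "spectator_dist x t k =
     (let s = t (enumerate (central_collisions x t) k) in norm (x (spectator x s) s - x 0 s) - 1)"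

end

theory Submission
  imports Defs
begin

text \<open>A collision does not increase the kinetic energy, so all velocities stay bounded after time
  \<open>0\<close> and the positions at the collision times have increments bounded by a multiple of those of
  \<open>(t\<^sub>n)\<close>. As \<open>(t\<^sub>n)\<close> converges, so do the positions. Each of the distances
  \<open>\<bar>x\<^sub>1 - x\<^sub>0\<bar>\<close> and \<open>\<bar>x\<^sub>2 - x\<^sub>0\<bar>\<close> equals \<open>1\<close> infinitely often, hence has limit \<open>1\<close>.\<close>

text \<open>Only the normal component \<open>q\<close> of the relative velocity enters the energy
  balance. The loss is \<open>2 * p * (q - p)\<close>, where \<open>p\<close> and
  \<open>q - p\<close> are the fractions (1 + r)/2 and (1 - r)/2 of \<open>q\<close>, so it is a
  nonnegative multiple of the square of \<open>q\<close>.\<close>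

lemma collision_energy_le:
  fixes u w \<omega> :: "'a::real_inner"
  assumes "norm \<omega> = 1" and "0 < r" "r < 1"
  defines "p \<equiv> ((1 + r) / 2) * ((u - w) \<bullet> \<omega>)"
  shows "(norm (u - p *\<^sub>R \<omega>))\<^sup>2 + (norm (w + p *\<^sub>R \<omega>))\<^sup>2 \<le> (norm u)\<^sup>2 + (norm w)\<^sup>2"
proof -
  define q where "q = (u - w) \<bullet> \<omega>"
  have "\<omega> \<bullet> \<omega> = 1"
    using assms(1) by (simp add: norm_eq_1)
  then have "(norm (u - p *\<^sub>R \<omega>))\<^sup>2 + (norm (w + p *\<^sub>R \<omega>))\<^sup>2
      = (norm u)\<^sup>2 + (norm w)\<^sup>2 - 2 * p * (q - p)"
    by (simp add: power2_norm_eq_inner q_def algebra_simps inner_commute)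
  moreover have "2 * p * (q - p) = (1 - r\<^sup>2) / 2 * q\<^sup>2"
    by (simp add: p_def q_def [symmetric] field_simps power2_eq_square)
  moreover have "(1 - r\<^sup>2) / 2 * q\<^sup>2 \<ge> 0"
    using assms by (simp add: power_le_one)
  ultimately show ?thesis by linarith
qed

text \<open>The increments of \<open>t\<close> telescope to a convergent series that dominates the
  increments of \<open>f\<close>; completeness then makes the series of these increments converge,
  and its partial sums are \<open>f n - f 0\<close>.\<close>

lemma convergent_of_increments_le:
  fixes f :: "nat \<Rightarrow> 'a::banach" and t :: "nat \<Rightarrow> real"
  assumes "convergent t" and "\<And>n. norm (f (Suc n) - f n) \<le> M * (t (Suc n) - t n)"
  shows "convergent f"
proof -
  obtain L where "t \<longlonglongrightarrow> L"
    using assms(1) by (auto simp: convergent_def)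
  then have "summable (\<lambda>n. M * (t (Suc n) - t n))"
    by (intro summable_mult telescope_summable)
  then have "summable (\<lambda>n. f (Suc n) - f n)"
    by (rule summable_comparison_test') (use assms(2) in auto)
  then have "convergent (\<lambda>n. \<Sum>k<n. f (Suc k) - f k)"
    by (simp add: summable_iff_convergent)
  then have "convergent (\<lambda>n. f n - f 0)"
    by (simp add: sum_lessThan_telescope)
  then show ?thesis
    using convergent_add [OF _ convergent_const [of "f 0"]] by fastforce
qed

text \<open>Along the indices where \<open>f\<close> takes the value \<open>c\<close> the
  subsequence is constant, and limits are unique in a Hausdorff space.\<close>

lemma limit_eq_of_infinitely_often:
  fixes f :: "nat \<Rightarrow> 'a::t2_space"
  assumes "convergent f" and "infinite {n. f n = c}"
  shows "f \<longlonglongrightarrow> c"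
proof -
  obtain L where L: "f \<longlonglongrightarrow> L"
    using assms(1) by (auto simp: convergent_def)
  let ?e = "enumerate {n. f n = c}"
  have "(f \<circ> ?e) \<longlonglongrightarrow> L"
    using L assms(2) by (intro LIMSEQ_subseq_LIMSEQ strict_mono_enumerate)
  moreover have "f \<circ> ?e = (\<lambda>_. c)"
    using enumerate_in_set [OF assms(2)] by auto
  ultimately show ?thesis
    using L LIMSEQ_const_iff by metis
qed

context
  fixes r \<tau> :: real and t :: "nat \<Rightarrow> real"
    and x v v' :: "nat \<Rightarrow> real \<Rightarrow> 'a::real_inner"
  assumes r: "0 < r" "r < 1" and collapse: "inelastic_collapse r \<tau> x v v' t"
begin

lemma collision_time: "t n \<in> {0..<\<tau>}" "\<exists>i j. collides x i j (t n)"
proof -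
  have "t n \<in> range t" by simp
  also have "range t = {s \<in> {0..<\<tau>}. \<exists>i j. collides x i j s}"
    using collapse by (simp add: inelastic_collapse_def)
  finally show "t n \<in> {0..<\<tau>}" "\<exists>i j. collides x i j (t n)" by auto
qed

lemma strict_mono_collision_times: "strict_mono t"
  using collapse by (simp add: inelastic_collapse_def)

text \<open>Since \<open>t\<close> enumerates all collision times in increasing order, such a
  collision would need an index strictly between \<open>n\<close> and \<open>Suc n\<close>.\<close>

lemma no_collision_between:
  assumes "s \<in> {t n<..<t (Suc n)}"
  shows "\<not> collides x i j s"
proof
  assume "collides x i j s"
  moreover have "s \<in> {0..<\<tau>}"
    using assms collision_time(1) [of n] collision_time(1) [of "Suc n"] by auto
  ultimately have "s \<in> range t"
    using collapse by (auto simp: inelastic_collapse_def)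
  then obtain m where "s = t m" by auto
  then have "n < m" "m < Suc n"
    using assms strict_mono_less [OF strict_mono_collision_times] by auto
  then show False by simp
qed

text \<open>The free-motion clause of the flow holds up to and including the right end of a
  collision-free interval, and \<open>v\<close> is the velocity just before an instant. It therefore
  still applies at the next collision time.\<close>

lemma free_motion:
  assumes "i < 3"
  shows "x i (t (Suc n)) = x i (t n) + (t (Suc n) - t n) *\<^sub>R v' i (t n)"
    and "v i (t (Suc n)) = v' i (t n)"
proof -
  have "t n < t (Suc n)" "0 \<le> t n" "t (Suc n) < \<tau>"
    using strict_mono_collision_times collision_time(1) [of n] collision_time(1) [of "Suc n"]
    by (auto simp: strict_mono_less)
  moreover have "\<forall>s\<in>{t n<..<t (Suc n)}. \<nexists>i j. collides x i j s"
    using no_collision_between by blast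
  moreover have "\<forall>a b. 0 \<le> a \<and> a < b \<and> b < \<tau> \<and> (\<forall>s\<in>{a<..<b}. \<nexists>i j. collides x i j s) \<longrightarrow>
      (\<forall>i<3. \<forall>s\<in>{a<..b}. x i s = x i a + (s - a) *\<^sub>R v' i a \<and> v i s = v' i a)"
    using collapse by (simp add: inelastic_collapse_def inelastic_flow_def)
  ultimately have "\<forall>i<3. \<forall>s\<in>{t n<..t (Suc n)}.
      x i s = x i (t n) + (s - t n) *\<^sub>R v' i (t n) \<and> v i s = v' i (t n)"
    by blast
  then show "x i (t (Suc n)) = x i (t n) + (t (Suc n) - t n) *\<^sub>R v' i (t n)"
    and "v i (t (Suc n)) = v' i (t n)"
    using assms \<open>t n < t (Suc n)\<close> by auto
qed

text \<open>The colliding pair loses energy or keeps it, and the third particle contributes the same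
  amount before and after.\<close>

lemma energy_at_collision_le:
  "(\<Sum>k<3. (norm (v' k (t n)))\<^sup>2) \<le> (\<Sum>k<3. (norm (v k (t n)))\<^sup>2)"
proof -
  define s where "s = t n"
  have s: "s \<in> {0..<\<tau>}"
    using collision_time(1) by (simp add: s_def)
  obtain i j where ij: "collides x i j s"
    using collision_time(2) unfolding s_def by blast
  then have lt: "i < 3" "j < 3" "i \<noteq> j" and "norm (x i s - x j s) = 1"
    by (auto simp: collides_def)
  then have unit: "norm (impact_dir x i j s) = 1"
    by (simp add: impact_dir_def)
  have no_triple: "{i, j} = {k, l}" if "collides x k l s" for k l
  proof -
    have "\<forall>s\<in>{0..<\<tau>}. \<forall>i j k l. collides x i j s \<and> collides x k l s \<longrightarrow> {i, j} = {k, l}"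
      using collapse by (simp add: inelastic_collapse_def no_triple_collision_def)
    from this [rule_format, OF s conjI, OF ij that] show ?thesis .
  qed
  have "\<forall>s\<in>{0..<\<tau>}. \<forall>k<3. (\<nexists>l. collides x k l s) \<longrightarrow> v' k s = v k s"
    using collapse by (simp add: inelastic_collapse_def inelastic_flow_def)
  \<comment> \<open>A collision of \<open>k\<close> with any \<open>l\<close> would force
    \<open>{i, j} = {k, l}\<close>, hence \<open>k\<close> in \<open>{i, j}\<close>; so
    \<open>k\<close> is not colliding and its velocity does not jump.\<close>
  then have spect: "v' k s = v k s" if "k \<in> {..<3} - {i, j}" for k
    using that s no_triple by blast
  define p where "p = ((1 + r) / 2) * ((v i s - v j s) \<bullet> impact_dir x i j s)"
  have "\<forall>s\<in>{0..<\<tau>}. \<forall>i j. collides x i j s \<longrightarrow>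
      (let \<omega> = impact_dir x i j s in
        v' i s = v i s - (((1 + r) / 2) * ((v i s - v j s) \<bullet> \<omega>)) *\<^sub>R \<omega> \<and>
        v' j s = v j s + (((1 + r) / 2) * ((v i s - v j s) \<bullet> \<omega>)) *\<^sub>R \<omega>)"
    using collapse unfolding inelastic_collapse_def inelastic_flow_def by (elim conjE)
  from this [rule_format, OF s ij]
  have "v' i s = v i s - p *\<^sub>R impact_dir x i j s" "v' j s = v j s + p *\<^sub>R impact_dir x i j s"
    by (simp_all add: Let_def p_def)
  then have "(norm (v' i s))\<^sup>2 + (norm (v' j s))\<^sup>2 \<le> (norm (v i s))\<^sup>2 + (norm (v j s))\<^sup>2"
    using collision_energy_le [OF unit r, of "v i s" "v j s"] by (simp add: p_def)
  moreover have "(\<Sum>k<3. f k) = f i + f j + (\<Sum>k\<in>{..<3} - {i, j}. f k)" for f :: "nat \<Rightarrow> real"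
    using lt sum.subset_diff [of "{i, j}" "{..<3}" f] by (simp add: add.commute)
  moreover have "(\<Sum>k\<in>{..<3} - {i, j}. (norm (v' k s))\<^sup>2) = (\<Sum>k\<in>{..<3} - {i, j}. (norm (v k s))\<^sup>2)"
    by (intro sum.cong) (simp_all add: spect)
  ultimately show ?thesis
    unfolding s_def [symmetric] by simp
qed

text \<open>Velocities just before a collision are those just after the preceding one, so the bounds
  at single collisions chain together. The reference values are the velocities after the collision
  at \<open>t 0\<close>, because time 0 is itself a collision time.\<close>

lemma energy_le_initial:
  "(\<Sum>k<3. (norm (v' k (t n)))\<^sup>2) \<le> (\<Sum>k<3. (norm (v' k (t 0)))\<^sup>2)"
proof (induction n)
  case (Suc n)
  have "(\<Sum>k<3. (norm (v' k (t (Suc n))))\<^sup>2) \<le> (\<Sum>k<3. (norm (v k (t (Suc n))))\<^sup>2)"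
    by (rule energy_at_collision_le)
  also have "\<dots> = (\<Sum>k<3. (norm (v' k (t n)))\<^sup>2)"
    by (intro sum.cong) (auto simp: free_motion)
  finally show ?case
    using Suc.IH by simp
qed simp

lemma velocity_le:
  assumes "i < 3"
  shows "norm (v' i (t n)) \<le> sqrt (\<Sum>k<3. (norm (v' k (t 0)))\<^sup>2)"
proof (rule real_le_rsqrt)
  have "(norm (v' i (t n)))\<^sup>2 \<le> (\<Sum>k<3. (norm (v' k (t n)))\<^sup>2)"
    using assms by (intro member_le_sum) auto
  also note energy_le_initial
  finally show "(norm (v' i (t n)))\<^sup>2 \<le> (\<Sum>k<3. (norm (v' k (t 0)))\<^sup>2)" .
qed

end

text \<open>The uniform velocity bound serves as the constant \<open>M\<close> relating position
  increments to time increments. Completeness of the space enters only here, hence the additional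
  sort \<open>banach\<close>.\<close>

lemma convergent_position:
  fixes x v v' :: "nat \<Rightarrow> real \<Rightarrow> 'a::{real_inner, banach}"
  assumes r: "0 < r" "r < 1" and collapse: "inelastic_collapse r \<tau> x v v' t" and "i < 3"
  shows "convergent (\<lambda>n. x i (t n))"
proof (rule convergent_of_increments_le)
  show "convergent t"
    using collapse by (auto simp: inelastic_collapse_def convergent_def)
  fix n
  have "t n < t (Suc n)"
    using strict_mono_collision_times [OF r collapse] by (simp add: strict_mono_less)
  then show "norm (x i (t (Suc n)) - x i (t n))
      \<le> sqrt (\<Sum>k<3. (norm (v' k (t 0)))\<^sup>2) * (t (Suc n) - t n)"
    using velocity_le [OF r collapse \<open>i < 3\<close>, of n]
    by (simp add: free_motion(1) [OF r collapse \<open>i < 3\<close>] mult.commute mult_right_mono)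
qed

theorem proposition2:
  fixes r \<tau> :: real and t :: "nat \<Rightarrow> real"
    and x v v' :: "nat \<Rightarrow> real \<Rightarrow> real ^ 'd"
  assumes "CARD('d) \<ge> 2"
    and "0 < r" and "r < 1"
    and "\<tau> > 0"
    and "inelastic_collapse r \<tau> x v v' t"
    and "infinite {n. collides x 0 1 (t n)}"
    and "infinite {n. collides x 0 2 (t n)}"
  shows "convergent (\<lambda>n. x 1 (t n) - x 0 (t n)) \<and>
         convergent (\<lambda>n. x 2 (t n) - x 0 (t n)) \<and>
         convergent (spectator_dist x t) \<and>
         spectator_dist x t \<longlonglongrightarrow> 0"
proof -
  have conv: "convergent (\<lambda>n. x i (t n) - x 0 (t n))" if "i < 3" for i
    using that assms by (intro convergent_diff convergent_position) auto
  \<comment> \<open>The gaps are taken at all collision times, not only those involving particle 0,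
    so that convergence of the positions applies directly.\<close>
  define gap where "gap i n = norm (x i (t n) - x 0 (t n)) - 1" for i n
  have gap: "gap i \<longlonglongrightarrow> 0" if "i = 1 \<or> i = 2" for i
  proof (rule limit_eq_of_infinitely_often)
    show "convergent (gap i)"
      unfolding gap_def using that by (intro convergent_diff convergent_norm conv convergent_const) auto
    \<comment> \<open>Contact of particles 0 and \<open>i\<close> is the same as a vanishing gap, so
      the gap is zero infinitely often.\<close>
    have "{n. gap i n = 0} = {n. collides x 0 i (t n)}"
      using that by (auto simp: gap_def collides_def norm_minus_commute)
    then show "infinite {n. gap i n = 0}"
      using that assms by auto
  qed
  let ?e = "enumerate (central_collisions x t)"
  have "infinite (central_collisions x t)"
    using assms by (simp add: central_collisions_def Collect_disj_eq)
  then have mono: "strict_mono ?e"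
    by (rule strict_mono_enumerate)
  \<comment> \<open>The spectator may change from one collision to the next; the sum of both gaps
    bounds the distance whichever particle it is.\<close>
  have "(\<lambda>n. \<bar>gap 1 (?e n)\<bar> + \<bar>gap 2 (?e n)\<bar>) \<longlonglongrightarrow> 0"
    using LIMSEQ_subseq_LIMSEQ [OF gap mono]
    by (intro tendsto_add_zero tendsto_rabs_zero) (auto simp: comp_def)
  moreover have "norm (spectator_dist x t n) \<le> \<bar>gap 1 (?e n)\<bar> + \<bar>gap 2 (?e n)\<bar>" for n
    by (simp add: spectator_dist_def spectator_def gap_def Let_def)
  ultimately have "spectator_dist x t \<longlonglongrightarrow> 0"
    by (rule Lim_null_comparison [OF always_eventually, rotated, OF _ allI])
  then show ?thesis
    using conv by (auto simp: convergent_def)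
qed

end
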